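(* Let $q$ be a prime power, let $m,n\ge 1$, and let $\mathcal{C}$ be an $[n,k,d]_{q^m/q}$ code. If $\mathcal{C}$ is minimal, then $\mathcal{C}$ is a $(2,1)$-separating rank-metric code.
   Context: Support and rank: fix an $\mathbb{F}_q$-basis $\Gamma$ of $\mathbb{F}_{q^m}$. For $x=(x_1,\dots,x_n)\in\mathbb{F}_{q^m}^n$ let $\mathrm{Mat}_\Gamma(x)\in\mathbb{F}_q^{m\times n}$ be the matrix whose $j$-th column is the coordinate vector of $x_j$ in the basis $\Gamma$. The support $\sigma(x)\subseteq\mathbb{F}_q^n$ is the $\mathbb{F}_q$-row space of $\mathrm{Mat}_\Gamma(x)$, and $\mathrm{rk}(x)=\dim_{\mathbb{F}_q}\sigma(x)$; both are independent of $\Gamma$. An $[n,k,d]_{q^m/q}$ code is an $\mathbb{F}_{q^m}$-linear subspace $\mathcal{C}$ of $\mathbb{F}_{q^m}^n$ with $k=\dim_{\mathbb{F}_{q^m}}\mathcal{C}\ge 1$ and minimum distance $d=\min_{c\in\mathcal{C}\setminus\{0\}}\mathrm{rk}(c)$. The code is minimal if for all nonzero $c,c'\in\mathcal{C}$, $\sigma(c)\subseteq\sigma(c')$ implies $c'=\lambda c$ for some $\lambda\in\mathbb{F}_{q^m}$. A subset $\mathcal{C}\subseteq\mathbb{F}_{q^m}^n$ is a $(2,1)$-separating rank-metric code if all pairwise distinct $x,y,z\in\mathcal{C}$ satisfy $\mathrm{rk}(x-z)<\mathrm{rk}(x-y)+\mathrm{rk}(y-z)$. *)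

theory Defs
  imports "HOL-Analysis.Analysis" "HOL-Number_Theory.Prime_Powers"
begin

text \<open>
  A finite field extension is modelled by two finite field types \<open>'k\<close> (the small field) and
  \<open>'l\<close> (the large field) together with an embedding \<open>\<iota> :: 'k \<Rightarrow> 'l\<close>, through which
  \<open>'l\<close> is a vector space over \<open>'k\<close>.
\<close>

definition field_embedding :: "('k::field \<Rightarrow> 'l::field) \<Rightarrow> bool" where
  "field_embedding \<iota> \<longleftrightarrow>
     \<iota> 1 = 1 \<and> (\<forall>a b. \<iota> (a + b) = \<iota> a + \<iota> b) \<and> (\<forall>a b. \<iota> (a * b) = \<iota> a * \<iota> b)"

definition ext_scale :: "('k::field \<Rightarrow> 'l::field) \<Rightarrow> 'k \<Rightarrow> 'l \<Rightarrow> 'l" where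
  "ext_scale \<iota> a x = \<iota> a * x"

lemma vector_space_ext_scale:
  assumes "field_embedding \<iota>"
  shows "vector_space (ext_scale \<iota>)"
  using assms by unfold_locales (simp_all add: field_embedding_def ext_scale_def algebra_simps)

definition ext_basis :: "('k::field \<Rightarrow> 'l::field) \<Rightarrow> ('m::finite \<Rightarrow> 'l) \<Rightarrow> bool" where
  "ext_basis \<iota> \<Gamma> \<longleftrightarrow>
     inj \<Gamma> \<and> \<not> module.dependent (ext_scale \<iota>) (range \<Gamma>) \<and>
     module.span (ext_scale \<iota>) (range \<Gamma>) = UNIV"

text \<open>Column \<open>j\<close> is the coordinate vector of \<open>x $ j\<close> with respect to \<open>\<Gamma>\<close>.\<close>

definition coord_matrix ::
    "('k::field \<Rightarrow> 'l::field) \<Rightarrow> ('m::finite \<Rightarrow> 'l) \<Rightarrow> 'l ^ 'n \<Rightarrow> 'k ^ 'n ^ 'm" where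
  "coord_matrix \<iota> \<Gamma> x =
     (\<chi> i j. module.representation (ext_scale \<iota>) (range \<Gamma>) (x $ j) (\<Gamma> i))"

definition rank_support ::
    "('k::field \<Rightarrow> 'l::field) \<Rightarrow> ('m::finite \<Rightarrow> 'l) \<Rightarrow> 'l ^ 'n \<Rightarrow> ('k ^ 'n) set" where
  "rank_support \<iota> \<Gamma> x = vec.span (rows (coord_matrix \<iota> \<Gamma> x))"

definition rank_weight ::
    "('k::field \<Rightarrow> 'l::field) \<Rightarrow> ('m::finite \<Rightarrow> 'l) \<Rightarrow> 'l ^ 'n \<Rightarrow> nat" where
  "rank_weight \<iota> \<Gamma> x = vec.dim (rank_support \<iota> \<Gamma> x)"

text \<open>
  The length of the code is \<open>CARD('n)\<close>. The minimum is over a finite nonempty set, since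
  \<open>'l\<close> is finite and \<open>k \<ge> 1\<close>.
\<close>

definition rank_metric_code ::
    "('k::field \<Rightarrow> 'l::{field,finite}) \<Rightarrow> ('m::finite \<Rightarrow> 'l) \<Rightarrow> nat \<Rightarrow> nat \<Rightarrow> ('l ^ 'n) set \<Rightarrow> bool" where
  "rank_metric_code \<iota> \<Gamma> k d C \<longleftrightarrow>
     vec.subspace C \<and> vec.dim C = k \<and> k \<ge> 1 \<and> d = Min (rank_weight \<iota> \<Gamma> ` (C - {0}))"

definition minimal_code ::
    "('k::field \<Rightarrow> 'l::field) \<Rightarrow> ('m::finite \<Rightarrow> 'l) \<Rightarrow> ('l ^ 'n) set \<Rightarrow> bool" where
  "minimal_code \<iota> \<Gamma> C \<longleftrightarrow>
     (\<forall>c \<in> C - {0}. \<forall>c' \<in> C - {0}.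
        rank_support \<iota> \<Gamma> c \<subseteq> rank_support \<iota> \<Gamma> c' \<longrightarrow> (\<exists>l. c' = l *s c))"

definition separating_2_1 ::
    "('k::field \<Rightarrow> 'l::field) \<Rightarrow> ('m::finite \<Rightarrow> 'l) \<Rightarrow> ('l ^ 'n) set \<Rightarrow> bool" where
  "separating_2_1 \<iota> \<Gamma> C \<longleftrightarrow>
     (\<forall>x \<in> C. \<forall>y \<in> C. \<forall>z \<in> C. x \<noteq> y \<and> y \<noteq> z \<and> x \<noteq> z \<longrightarrow>
        rank_weight \<iota> \<Gamma> (x - z) < rank_weight \<iota> \<Gamma> (x - y) + rank_weight \<iota> \<Gamma> (y - z))"

end

theory Submission
  imports Defs
begin

text \<open>
  Put \<open>u = x - y\<close>, \<open>v = y - z\<close>, so that \<open>u + v = x - z\<close>. Since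
  \<open>\<sigma>(u + v) \<subseteq> \<sigma>(u) + \<sigma>(v)\<close>, failure of the strict inequality forces
  \<open>\<sigma>(u + v) = \<sigma>(u) + \<sigma>(v) \<supseteq> \<sigma>(u)\<close>, and minimality gives \<open>u + v = \<lambda>u\<close>. Scaling does not
  enlarge the support, so \<open>rk(u) + rk(v) \<le> rk(\<lambda>u) \<le> rk(u)\<close> and \<open>v = 0\<close>, a contradiction.
\<close>

locale extension_with_basis =
  fixes \<iota> :: "'k::field \<Rightarrow> 'l::field" and \<Gamma> :: "'m::finite \<Rightarrow> 'l"
  assumes embedding: "field_embedding \<iota>" and basis: "ext_basis \<iota> \<Gamma>"
begin

sublocale ext: vector_space "ext_scale \<iota>"
  using embedding by (rule vector_space_ext_scale)

text \<open>The coordinate functionals of the basis. Applied entrywise to a vector,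
  \<open>coord i\<close> gives row \<open>i\<close> of its coordinate matrix, so facts about
  supports reduce to linearity of these maps over the small field.\<close>

definition coord :: "'m \<Rightarrow> 'l \<Rightarrow> 'k" where
  "coord i a = ext.representation (range \<Gamma>) a (\<Gamma> i)"

lemma coord_add: "coord i (a + b) = coord i a + coord i b"
  using basis by (simp add: coord_def ext_basis_def ext.representation_add)

lemma coord_scale: "coord i (\<iota> c * a) = c * coord i a"
  using basis ext.representation_scale[of "range \<Gamma>" a c]
  by (simp add: coord_def ext_basis_def ext_scale_def)

lemma coord_zero: "coord i 0 = 0"
  using coord_add[of i 0 0] by (metis add_0_left add_cancel_right_right)

lemma coord_sum: "coord i (sum f A) = (\<Sum>a\<in>A. coord i (f a))"
  by (induction A rule: infinite_finite_induct) (simp_all add: coord_add coord_zero)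

lemma sum_coord: "(\<Sum>i\<in>UNIV. \<iota> (coord i a) * \<Gamma> i) = a"
proof -
  have "(\<Sum>b\<in>range \<Gamma>. ext_scale \<iota> (ext.representation (range \<Gamma>) a b) b) = a"
    using basis by (intro ext.sum_representation_eq) (auto simp: ext_basis_def)
  then show ?thesis
    \<comment> \<open>Injectivity of \<Gamma> turns the sum over the basis as a set into a sum over
      its indices.\<close>
    using basis by (simp add: sum.reindex coord_def ext_basis_def ext_scale_def)
qed

lemma rank_support_eq_span:
  "rank_support \<iota> \<Gamma> x = vec.span (range (\<lambda>i. \<chi> j. coord i (x $ j)))"
proof -
  have "rows (coord_matrix \<iota> \<Gamma> x) = range (\<lambda>i. \<chi> j. coord i (x $ j))"
    by (auto simp: rows_def row_def coord_matrix_def coord_def)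
  then show ?thesis by (simp add: rank_support_def)
qed

lemma subspace_rank_support: "vec.subspace (rank_support \<iota> \<Gamma> x)"
  by (simp add: rank_support_def)

lemma coord_row_in_rank_support: "(\<chi> j. coord i (x $ j)) \<in> rank_support \<iota> \<Gamma> x"
  unfolding rank_support_eq_span by (intro vec.span_base rangeI)

lemma rank_support_subsetI:
  assumes "vec.subspace S" and "\<And>i. (\<chi> j. coord i (x $ j)) \<in> S"
  shows "rank_support \<iota> \<Gamma> x \<subseteq> S"
  unfolding rank_support_eq_span using assms by (intro vec.span_minimal) auto

lemma rank_support_add:
  "rank_support \<iota> \<Gamma> (x + y) \<subseteq> {a + b |a b. a \<in> rank_support \<iota> \<Gamma> x \<and> b \<in> rank_support \<iota> \<Gamma> y}"
proof (rule rank_support_subsetI)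
  show "vec.subspace {a + b |a b. a \<in> rank_support \<iota> \<Gamma> x \<and> b \<in> rank_support \<iota> \<Gamma> y}"
    by (intro vec.subspace_sums subspace_rank_support)
  fix i
  have "(\<chi> j. coord i ((x + y) $ j)) = (\<chi> j. coord i (x $ j)) + (\<chi> j. coord i (y $ j))"
    by (simp add: vec_eq_iff coord_add)
  then show "(\<chi> j. coord i ((x + y) $ j)) \<in>
      {a + b |a b. a \<in> rank_support \<iota> \<Gamma> x \<and> b \<in> rank_support \<iota> \<Gamma> y}"
    using coord_row_in_rank_support by blast
qed

text \<open>Multiplication by \<open>l\<close> is linear over the small field, so on coordinates it
  acts as a matrix with entries \<open>coord i (l * \<Gamma> t)\<close>. The rows of
  \<open>l *s x\<close> are thus combinations of the rows of \<open>x\<close> with coefficients in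
  the small field.\<close>

lemma rank_support_scale: "rank_support \<iota> \<Gamma> (l *s x) \<subseteq> rank_support \<iota> \<Gamma> x"
proof (rule rank_support_subsetI[OF subspace_rank_support])
  fix i
  have coord_mult: "coord i (l * a) = (\<Sum>t\<in>UNIV. coord i (l * \<Gamma> t) * coord t a)" for a
  proof -
    have "l * a = (\<Sum>t\<in>UNIV. \<iota> (coord t a) * (l * \<Gamma> t))"
      by (subst (1) sum_coord[of a, symmetric]) (simp add: sum_distrib_left mult.left_commute)
    then have "coord i (l * a) = coord i (\<Sum>t\<in>UNIV. \<iota> (coord t a) * (l * \<Gamma> t))"
      by (rule arg_cong)
    then show ?thesis
      unfolding coord_sum coord_scale by (subst mult.commute)
  qed
  have "(\<chi> j. coord i ((l *s x) $ j)) =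
      (\<Sum>t\<in>UNIV. coord i (l * \<Gamma> t) *s (\<chi> j. coord t (x $ j)))"
    \<comment> \<open>Only products with entries of \<open>x\<close> may be rewritten: in general
      form \<open>coord_mult\<close> would apply again to the terms
      \<open>coord i (l * \<Gamma> t)\<close> that it produces.\<close>
    by (simp add: vec_eq_iff coord_mult[of "x $ _"])
  then show "(\<chi> j. coord i ((l *s x) $ j)) \<in> rank_support \<iota> \<Gamma> x"
    by (simp only:) (intro vec.subspace_sum vec.subspace_scale subspace_rank_support
        coord_row_in_rank_support)
qed

lemma rank_weight_scale_le: "rank_weight \<iota> \<Gamma> (l *s x) \<le> rank_weight \<iota> \<Gamma> x"
  unfolding rank_weight_def by (rule vec.dim_subset[OF rank_support_scale])

text \<open>A zero-dimensional support makes every coordinate row zero, and \<open>sum_coord\<close>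
  rebuilds each entry from its coordinates.\<close>

lemma rank_weight_eq_0D:
  assumes "rank_weight \<iota> \<Gamma> x = 0"
  shows "x = 0"
proof -
  have "rank_support \<iota> \<Gamma> x \<subseteq> {0}"
    using assms by (simp add: rank_weight_def vec.dim_eq_0)
  then have "(\<chi> j. coord i (x $ j)) = 0" for i
    using coord_row_in_rank_support by blast
  then have "coord i (x $ j) = 0" for i j
    by (simp add: vec_eq_iff)
  moreover have "\<iota> 0 = 0"
    using embedding unfolding field_embedding_def by (metis add_cancel_right_right)
  ultimately have "x $ j = 0" for j
    using sum_coord[of "x $ j"] by simp
  then show ?thesis by (simp add: vec_eq_iff)
qed

lemma rank_support_subset_add:
  assumes "rank_weight \<iota> \<Gamma> x + rank_weight \<iota> \<Gamma> y \<le> rank_weight \<iota> \<Gamma> (x + y)"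
  shows "rank_support \<iota> \<Gamma> x \<subseteq> rank_support \<iota> \<Gamma> (x + y)"
proof -
  let ?S = "{a + b |a b. a \<in> rank_support \<iota> \<Gamma> x \<and> b \<in> rank_support \<iota> \<Gamma> y}"
  have "vec.dim ?S \<le> rank_weight \<iota> \<Gamma> x + rank_weight \<iota> \<Gamma> y"
    \<comment> \<open>The dimension formula for a sum of subspaces, with the dimension of the
      intersection dropped.\<close>
    using vec.dim_sums_Int[OF subspace_rank_support subspace_rank_support, of x y]
    by (simp add: rank_weight_def)
  then have "rank_support \<iota> \<Gamma> (x + y) = ?S"
    using assms
    \<comment> \<open>The support of \<open>x + y\<close> lies in \<open>?S\<close> and, by the
      assumption, has at least its dimension, so the two coincide.\<close>
    by (intro vec.subspace_dim_equal subspace_rank_support vec.subspace_sums rank_support_add)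
      (simp add: rank_weight_def)
  moreover have "rank_support \<iota> \<Gamma> x \<subseteq> ?S"
    using vec.subspace_0[OF subspace_rank_support[of y]] by force
  ultimately show ?thesis by simp
qed

lemma minimal_code_imp_separating:
  assumes "vec.subspace C" and minimal: "minimal_code \<iota> \<Gamma> C"
  shows "separating_2_1 \<iota> \<Gamma> C"
  unfolding separating_2_1_def
proof (intro ballI impI)
  fix x y z
  assume xyz: "x \<in> C" "y \<in> C" "z \<in> C" "x \<noteq> y \<and> y \<noteq> z \<and> x \<noteq> z"
  define u v where "u = x - y" and "v = y - z"
  have uv: "u + v = x - z" "u \<in> C - {0}" "u + v \<in> C - {0}" "v \<noteq> 0"
    \<comment> \<open>Each inequality among \<open>x\<close>, \<open>y\<close>, \<open>z\<close> has
      its use: those for \<open>u\<close> and \<open>u + v\<close> make them admissible in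
      minimality, and \<open>v \<noteq> 0\<close> gives the final contradiction.\<close>
    using xyz vec.subspace_diff[OF \<open>vec.subspace C\<close>] by (auto simp: u_def v_def)
  have "rank_weight \<iota> \<Gamma> (u + v) < rank_weight \<iota> \<Gamma> u + rank_weight \<iota> \<Gamma> v"
  proof (rule ccontr)
    assume "\<not> ?thesis"
    then have le: "rank_weight \<iota> \<Gamma> u + rank_weight \<iota> \<Gamma> v \<le> rank_weight \<iota> \<Gamma> (u + v)"
      by simp
    from rank_support_subset_add[OF this] obtain l where "u + v = l *s u"
      using minimal uv unfolding minimal_code_def by blast
    then have "rank_weight \<iota> \<Gamma> v = 0"
      using le rank_weight_scale_le[of l u] by simp
    then show False using rank_weight_eq_0D uv by blast
  qed
  then show "rank_weight \<iota> \<Gamma> (x - z) < rank_weight \<iota> \<Gamma> (x - y) + rank_weight \<iota> \<Gamma> (y - z)"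
    using uv by (simp add: u_def v_def)
qed

end

theorem theorem5p5:
  fixes \<iota> :: "'k::{field,finite} \<Rightarrow> 'l::{field,finite}"
    and \<Gamma> :: "'m::finite \<Rightarrow> 'l"
    and C :: "('l ^ 'n::finite) set"
    and q m n k d :: nat
  assumes "primepow q" and "m \<ge> 1" and "n \<ge> 1"
    and "CARD('k) = q" and "CARD('l) = q ^ m" and "CARD('n) = n"
    and "field_embedding \<iota>"
    and "ext_basis \<iota> \<Gamma>"
    and "rank_metric_code \<iota> \<Gamma> k d C"
    and "minimal_code \<iota> \<Gamma> C"
  shows "separating_2_1 \<iota> \<Gamma> C"
proof -
  interpret extension_with_basis \<iota> \<Gamma>
    using assms by unfold_locales
  show ?thesis
    using assms by (intro minimal_code_imp_separating) (auto simp: rank_metric_code_def)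
qed

end
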